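(* Let $\alpha\in(0,1]$ and let $h$ be an $\alpha$-strong function. Let $F$ be a distribution function as in the context. For $n\ge1$ consider the threshold algorithm on $n$ i.i.d. items $X_1,\dots,X_n$ with distribution $F$ that uses thresholds $\theta_i=F^{-1}\!\big(h(i/n)/h((i-1)/n)\big)$, $i=1,\dots,n$, and picks the first item $i$ with $X_i\ge\theta_i$ (value $0$ if none). Then for every $\epsilon>0$ there exists $n_\epsilon$ such that for every $n\geq n_\epsilon$ this algorithm is at least a $(1-\epsilon)\alpha$-approximation, i.e. $\mathbb{E}[X_\tau]\ge(1-\epsilon)\alpha\,\mathbb{E}[\max_i X_i]$ where $X_\tau$ is the picked value.
   Context: $F$ is the distribution function of a nonnegative random variable, continuous and strictly increasing on a subinterval of $\mathbb{R}_{\ge0}$. A threshold function is a continuous, strictly decreasing, differentiable function $h:[0,1]\to[0,1]$ with $h(0)=1$ and $h>0$ on $[0,1]$ (so that $h'/h$ is defined), such that (i) $h$ is strictly concave, and (ii) for every $\epsilon>0$ there exists $\delta_0\le\epsilon$ such that for every $\delta\le\delta_0$ and every $s$ with $\epsilon+\delta\le s\le1$, $\frac{h'(s-\delta)}{h(s-\delta)}\le(1-\epsilon)\frac{h'(s)}{h(s)}$. A threshold function $h$ is $\alpha$-strong if (i) $h(1)\le 1-\alpha$; (ii) $\int_0^1 h(r)\,dr\ge\alpha$; (iii) for all $0\le s\le1$, $1-h(s)-\frac{h'(s)}{h(s)}\int_s^1 h(r)\,dr\ \ge\ \alpha\left(1-\exp\!\left(\frac{h'(s)}{h(s)}\right)\right)$.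 Items are revealed in order and each must be irrevocably accepted (stopping) or rejected. *)

theory Defs
  imports "HOL-Probability.Probability"
begin

definition strictly_concave_on :: "real set \<Rightarrow> (real \<Rightarrow> real) \<Rightarrow> bool" where
  "strictly_concave_on S f \<longleftrightarrow> convex S \<and>
     (\<forall>x\<in>S. \<forall>y\<in>S. \<forall>t. x \<noteq> y \<longrightarrow> 0 < t \<longrightarrow> t < 1 \<longrightarrow>
        (1 - t) * f x + t * f y < f ((1 - t) * x + t * y))"

text \<open>The derivative relative to the domain \<open>[0,1]\<close>, hence one-sided at the endpoints.\<close>

definition unit_deriv :: "(real \<Rightarrow> real) \<Rightarrow> real \<Rightarrow> real" where
  "unit_deriv h s = vector_derivative h (at s within {0..1})"

lemma unit_deriv_eqI:
  assumes "s \<in> {0..1}" "(h has_real_derivative D) (at s within {0..1})"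
  shows "unit_deriv h s = D"
  using assms
  by (simp add: unit_deriv_def has_real_derivative_iff_has_vector_derivative
      vector_derivative_within_closed_interval)

definition threshold_function :: "(real \<Rightarrow> real) \<Rightarrow> bool" where
  "threshold_function h \<longleftrightarrow>
     h \<in> {0..1} \<rightarrow> {0..1} \<and> continuous_on {0..1} h \<and> strict_antimono_on {0..1} h \<and>
     h differentiable_on {0..1} \<and> h 0 = 1 \<and> (\<forall>s\<in>{0..1}. 0 < h s) \<and>
     strictly_concave_on {0..1} h \<and>
     (\<forall>\<epsilon>>0. \<exists>\<delta>\<^sub>0>0. \<delta>\<^sub>0 \<le> \<epsilon> \<and>
        (\<forall>\<delta> s. 0 < \<delta> \<longrightarrow> \<delta> \<le> \<delta>\<^sub>0 \<longrightarrow> \<epsilon> + \<delta> \<le> s \<longrightarrow> s \<le> 1 \<longrightarrow>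
           unit_deriv h (s - \<delta>) / h (s - \<delta>) \<le> (1 - \<epsilon>) * (unit_deriv h s / h s)))"

definition strong_threshold :: "real \<Rightarrow> (real \<Rightarrow> real) \<Rightarrow> bool" where
  "strong_threshold \<alpha> h \<longleftrightarrow> threshold_function h \<and>
     h 1 \<le> 1 - \<alpha> \<and>
     \<alpha> \<le> integral {0..1} h \<and>
     (\<forall>s\<in>{0..1}. \<alpha> * (1 - exp (unit_deriv h s / h s))
        \<le> 1 - h s - unit_deriv h s / h s * integral {s..1} h)"

definition nonneg_distribution_function :: "(real \<Rightarrow> real) \<Rightarrow> bool" where
  "nonneg_distribution_function F \<longleftrightarrow>
     (\<exists>D. real_distribution D \<and> (AE x in D. 0 \<le> x) \<and> cdf D = F)"

text \<open>\<open>I\<close> is the interval on which \<open>F\<close> climbs from 0 to 1. Together with continuity, the last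
  condition makes \<open>F\<close> restricted to \<open>I\<close> invertible at every level strictly between 0 and 1.\<close>

definition continuous_increasing_on_interval :: "(real \<Rightarrow> real) \<Rightarrow> real set \<Rightarrow> bool" where
  "continuous_increasing_on_interval F I \<longleftrightarrow>
     continuous_on UNIV F \<and> is_interval I \<and> I \<subseteq> {0..} \<and> strict_mono_on I F \<and>
     (\<forall>x. 0 < F x \<and> F x < 1 \<longrightarrow> x \<in> I)"

definition threshold :: "(real \<Rightarrow> real) \<Rightarrow> (real \<Rightarrow> real) \<Rightarrow> real set \<Rightarrow> nat \<Rightarrow> nat \<Rightarrow> real" where
  "threshold h F I n i = the_inv_into I F (h (real i / real n) / h ((real i - 1) / real n))"

definition picked_value :: "nat \<Rightarrow> (nat \<Rightarrow> real) \<Rightarrow> (nat \<Rightarrow> real) \<Rightarrow> real" where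
  "picked_value n \<theta> x =
     (if \<exists>i\<in>{1..n}. \<theta> i \<le> x i then x (LEAST i. i \<in> {1..n} \<and> \<theta> i \<le> x i) else 0)"

definition iid_items :: "'a measure \<Rightarrow> nat \<Rightarrow> (nat \<Rightarrow> 'a \<Rightarrow> real) \<Rightarrow> (real \<Rightarrow> real) \<Rightarrow> bool" where
  "iid_items M n X F \<longleftrightarrow> prob_space M \<and>
     prob_space.indep_vars M (\<lambda>_. borel) X {1..n} \<and>
     (\<forall>i\<in>{1..n}. cdf (distr M borel (X i)) = F)"

end

theory Submission
  imports Defs "HOL-Real_Asymp.Real_Asymp"
begin

text \<open>Both expectations are integrals of tail probabilities, so it suffices to compare the tails at
  each level \<open>t\<close>. Put \<open>z = 1 - F t\<close>. All of the first \<open>i\<close> items are rejected with probability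
  \<open>h (i/n)\<close>, so the picked value exceeds \<open>t\<close> with probability
  \<open>\<Sum>i<n. min (h (i/n) - h ((i+1)/n)) (z * h (i/n))\<close>. As \<open>h\<close> is log-concave, the first term is the
  smaller one exactly on an initial segment \<open>i < k\<close>; comparing the remaining sum with an integral
  gives the lower bound \<open>1 - h s + c * integral {s..1} h\<close> with \<open>s = k/n\<close> and \<open>c = n * z\<close>. Minimise
  this over \<open>s\<close>: at an interior minimum \<open>c = - h' s / h s\<close>, and at the end points the other two
  conditions of an \<open>\<alpha>\<close>-strong function apply, so it is always at least \<open>\<alpha> * (1 - exp (- c))\<close>.
  Finally \<open>1 - (1 - c/n)^n \<le> (1 + 2/n) * (1 - exp (- c))\<close>.\<close>

section \<open>Real inequalities\<close>

lemma exp_mult_le_one_minus_power: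
  fixes u :: real
  assumes "\<bar>u\<bar> \<le> 1"
  shows "(1 - real n * u\<^sup>2) * exp (- (real n * u)) \<le> (1 - u) ^ n"
proof -
  have "u\<^sup>2 \<le> 1"
    using assms by (simp add: abs_square_le_1)
  then have "1 - real n * u\<^sup>2 \<le> (1 - u\<^sup>2) ^ n"
    using Bernoulli_inequality[of "- (u\<^sup>2)" n] by simp
  also have "\<dots> = ((1 - u) * (1 + u)) ^ n"
    by (simp add: algebra_simps power2_eq_square)
  also have "\<dots> \<le> ((1 - u) * exp u) ^ n"
    using assms by (intro power_mono mult_left_mono) auto
  also have "\<dots> = (1 - u) ^ n * exp (real n * u)"
    by (simp add: power_mult_distrib exp_of_nat_mult)
  finally show ?thesis
    by (simp add: exp_minus field_simps)
qed

lemma square_mult_exp_minus_le: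
  fixes x :: real
  assumes "0 \<le> x"
  shows "x\<^sup>2 * exp (- x) \<le> 2 * (1 - exp (- x))"
  using exp_lower_Taylor_quadratic[OF assms] assms by (simp add: exp_minus field_simps)

lemma one_minus_power_le_one_minus_exp:
  fixes z :: real
  assumes "0 \<le> z" "z \<le> 1"
  shows "1 - (1 - z) ^ n \<le> (1 + 2 / real n) * (1 - exp (- (real n * z)))"
proof (cases "n = 0")
  case False
  let ?e = "exp (- (real n * z))"
  have "1 - (1 - z) ^ n \<le> 1 - (1 - real n * z\<^sup>2) * ?e"
    using exp_mult_le_one_minus_power[of z n] assms by simp
  also have "\<dots> = 1 - ?e + (real n * z)\<^sup>2 * ?e / real n"
    using False by (simp add: field_simps power2_eq_square)
  also have "\<dots> \<le> 1 - ?e + 2 * (1 - ?e) / real n"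
    using square_mult_exp_minus_le[of "real n * z"] assms
    by (intro add_left_mono divide_right_mono) auto
  also have "\<dots> = (1 + 2 / real n) * (1 - ?e)"
    by (simp add: distrib_right)
  finally show ?thesis .
qed simp

lemma eventually_one_minus_less_inverse:
  fixes \<epsilon> :: real
  assumes "0 < \<epsilon>"
  shows "\<forall>\<^sub>F n in sequentially. 1 - \<epsilon> < 1 / (1 + 2 / real n)"
proof (rule order_tendstoD(1))
  show "(\<lambda>n. 1 / (1 + 2 / real n)) \<longlonglongrightarrow> 1"
    by real_asymp
qed (use assms in simp)

lemma lower_bound_from_critical_points:
  fixes f f' :: "real \<Rightarrow> real"
  assumes cont: "continuous_on {a..b} f"
    and deriv: "\<And>x. a < x \<Longrightarrow> x < b \<Longrightarrow> (f has_real_derivative f' x) (at x)"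
    and endpoints: "v \<le> f a" "v \<le> f b"
    and critical: "\<And>x. a < x \<Longrightarrow> x < b \<Longrightarrow> f' x = 0 \<Longrightarrow> v \<le> f x"
    and x: "x \<in> {a..b}"
  shows "v \<le> f x"
proof -
  obtain m where m: "m \<in> {a..b}" and min: "\<And>y. y \<in> {a..b} \<Longrightarrow> f m \<le> f y"
    using continuous_attains_inf[OF compact_Icc _ cont] x by blast
  have "v \<le> f m"
  proof (cases "m = a \<or> m = b")
    case False
    then have inner: "a < m" "m < b"
      using m by auto
    have "f' m = 0"
    proof (rule DERIV_local_min[OF deriv[OF inner]])
      show "0 < min (m - a) (b - m)"
        using inner by simp
      show "\<forall>y. \<bar>m - y\<bar> < min (m - a) (b - m) \<longrightarrow> f m \<le> f y"
        by (auto intro!: min)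
    qed
    then show ?thesis
      using critical inner by blast
  qed (use endpoints in auto)
  also have "\<dots> \<le> f x"
    using min x by blast
  finally show ?thesis .
qed

lemma integral_antimono_le_left_sum:
  fixes f :: "real \<Rightarrow> real" and p :: "nat \<Rightarrow> real"
  assumes "mono p" "k \<le> n"
    and int: "f integrable_on {p k..p n}" and anti: "antimono_on {p k..p n} f"
  shows "integral {p k..p n} f \<le> (\<Sum>i=k..<n. (p (Suc i) - p i) * f (p i))"
  using \<open>k \<le> n\<close>
proof (induction rule: dec_induct)
  case (step m)
  have p: "p k \<le> p m" "p m \<le> p (Suc m)" "p (Suc m) \<le> p n"
    using step.hyps by (auto intro: monoD[OF \<open>mono p\<close>])
  have "integral {p k..p (Suc m)} f = integral {p k..p m} f + integral {p m..p (Suc m)} f"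
    using p by (intro Henstock_Kurzweil_Integration.integral_combine[symmetric]
        integrable_on_subinterval[OF int]) auto
  also have "integral {p m..p (Suc m)} f \<le> integral {p m..p (Suc m)} (\<lambda>_. f (p m))"
    using p by (intro integral_le integrable_on_subinterval[OF int] monotone_onD[OF anti]) auto
  also have "\<dots> = (p (Suc m) - p m) * f (p m)"
    using p by simp
  finally show ?case
    using step by simp
qed simp

lemma sum_min_single_crossing:
  fixes f g :: "nat \<Rightarrow> 'a :: {linorder, comm_monoid_add}"
  assumes stays: "\<And>i. Suc i < n \<Longrightarrow> g i \<le> f i \<Longrightarrow> g (Suc i) \<le> f (Suc i)"
  obtains k where "k \<le> n" "(\<Sum>i<n. min (f i) (g i)) = sum f {..<k} + sum g {k..<n}"
proof
  define crossed where "crossed i \<longleftrightarrow> i = n \<or> g i \<le> f i" for i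
  define k where "k = (LEAST i. crossed i)"
  have "crossed n"
    by (simp add: crossed_def)
  then show "k \<le> n"
    unfolding k_def by (rule Least_le)
  have "crossed k"
    unfolding k_def using \<open>crossed n\<close> by (rule LeastI)
  have before: "f i \<le> g i" if "i < k" for i
    using not_less_Least[of i crossed] that by (auto simp: k_def crossed_def)
  have after: "g i \<le> f i" if "k \<le> i" "i < n" for i
    using that
  proof (induction i rule: dec_induct)
    case base
    then show ?case
      using \<open>crossed k\<close> by (simp add: crossed_def)
  qed (simp add: stays)
  have "(\<Sum>i<n. min (f i) (g i)) = (\<Sum>i<k. min (f i) (g i)) + (\<Sum>i=k..<n. min (f i) (g i))"
    unfolding lessThan_atLeast0 using \<open>k \<le> n\<close>
    by (intro sum.atLeastLessThan_concat[symmetric]) auto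
  then show "(\<Sum>i<n. min (f i) (g i)) = sum f {..<k} + sum g {k..<n}"
    using before after by (simp add: min_absorb1 min_absorb2)
qed

lemma concave_on_mult_le_square_midpoint:
  assumes "concave_on S f" "x \<in> S" "y \<in> S" "0 \<le> f x" "0 \<le> f y"
  shows "f x * f y \<le> (f (midpoint x y))\<^sup>2"
proof -
  have "f x * f y \<le> ((f x + f y) / 2)\<^sup>2"
    using zero_le_power2[of "f x - f y"] by (simp add: power2_eq_square field_simps)
  also have "\<dots> \<le> (f (midpoint x y))\<^sup>2"
    using assms concave_onD[OF assms(1), of "1 / 2" x y]
    by (intro power_mono) (auto simp: midpoint_def scaleR_add_right inverse_eq_divide)
  finally show ?thesis .
qed

section \<open>Strong threshold functions\<close>

lemma strictly_concave_on_imp_concave_on: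
  assumes "strictly_concave_on S f"
  shows "concave_on S f"
  using assms unfolding strictly_concave_on_def
  by (intro concave_on_linorderI) (auto simp: less_imp_le)

lemma strict_antimono_on_imp_antimono_on:
  fixes f :: "'a :: order \<Rightarrow> 'b :: order"
  assumes "strict_antimono_on S f"
  shows "antimono_on S f"
  using assms by (fastforce simp: monotone_on_def le_less)

lemma
  assumes "threshold_function h"
  shows threshold_function_continuous_on: "continuous_on {0..1} h"
    and threshold_function_strict_antimono_on: "strict_antimono_on {0..1} h"
    and threshold_function_differentiable_on: "h differentiable_on {0..1}"
    and threshold_function_at_0: "h 0 = 1"
    and threshold_function_pos: "\<And>s. s \<in> {0..1} \<Longrightarrow> 0 < h s"
    and threshold_function_concave_on: "concave_on {0..1} h"
  using assms strictly_concave_on_imp_concave_on unfolding threshold_function_def by blast+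

lemma
  assumes "strong_threshold \<alpha> h"
  shows strong_threshold_imp_threshold_function: "threshold_function h"
    and strong_threshold_at_1_le: "h 1 \<le> 1 - \<alpha>"
    and strong_threshold_le_integral: "\<alpha> \<le> integral {0..1} h"
    and strong_threshold_le_log_deriv: "\<And>s. s \<in> {0..1} \<Longrightarrow>
      \<alpha> * (1 - exp (unit_deriv h s / h s))
        \<le> 1 - h s - unit_deriv h s / h s * integral {s..1} h"
  using assms unfolding strong_threshold_def by blast+

lemma differentiable_on_has_unit_deriv:
  assumes "h differentiable_on {0..1}" "s \<in> {0..1}"
  shows "(h has_real_derivative unit_deriv h s) (at s within {0..1})"
proof -
  obtain D where D: "(h has_real_derivative D) (at s within {0..1})"
    using assms unfolding differentiable_on_def by (meson real_differentiable_def)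
  then show ?thesis
    using unit_deriv_eqI[OF assms(2) D] by simp
qed

text \<open>The limiting probability that the picked value exceeds a level which \<open>c\<close> of the items exceed
  on average, if up to time \<open>s\<close> every accepted item exceeds it and after \<open>s\<close> every item that exceeds
  it is accepted.\<close>

definition switching_tail :: "(real \<Rightarrow> real) \<Rightarrow> real \<Rightarrow> real \<Rightarrow> real" where
  "switching_tail h c s = 1 - h s + c * integral {s..1} h"

lemma switching_tail_has_real_derivative:
  assumes "continuous_on {0..1} h" "h differentiable_on {0..1}" "s \<in> {0..1}"
  shows "(switching_tail h c has_real_derivative - unit_deriv h s - c * h s) (at s within {0..1})"
  unfolding switching_tail_def[abs_def]
  using differentiable_on_has_unit_deriv[OF assms(2,3)]
    integral_has_real_derivative'[OF assms(1,3)]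
  by (auto intro!: derivative_eq_intros)

lemma strong_threshold_le_switching_tail:
  assumes "0 < \<alpha>" and strong: "strong_threshold \<alpha> h" and "0 \<le> c" and "s \<in> {0..1}"
  shows "\<alpha> * (1 - exp (- c)) \<le> switching_tail h c s"
proof (rule lower_bound_from_critical_points[OF _ _ _ _ _ \<open>s \<in> {0..1}\<close>])
  note h = strong_threshold_imp_threshold_function[OF strong]
  note deriv = switching_tail_has_real_derivative[OF threshold_function_continuous_on[OF h]
      threshold_function_differentiable_on[OF h]]
  show "continuous_on {0..1} (switching_tail h c)"
    using deriv by (intro DERIV_continuous_on)
  show "(switching_tail h c has_real_derivative - unit_deriv h x - c * h x) (at x)"
    if "0 < x" "x < 1" for x
    using deriv[of x] that by (simp add: at_within_Icc_at)
  have "\<alpha> * (1 - exp (- c)) \<le> \<alpha> * c"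
    using exp_ge_add_one_self[of "- c"] \<open>0 < \<alpha>\<close> by simp
  also have "\<dots> \<le> c * integral {0..1} h"
    using mult_right_mono[OF strong_threshold_le_integral[OF strong] \<open>0 \<le> c\<close>]
    by (simp add: mult.commute)
  finally show "\<alpha> * (1 - exp (- c)) \<le> switching_tail h c 0"
    by (simp add: switching_tail_def threshold_function_at_0[OF h])
  have "\<alpha> * (1 - exp (- c)) \<le> \<alpha>"
    using \<open>0 < \<alpha>\<close> by simp
  also have "\<dots> \<le> 1 - h 1"
    using strong_threshold_at_1_le[OF strong] by simp
  finally show "\<alpha> * (1 - exp (- c)) \<le> switching_tail h c 1"
    by (simp add: switching_tail_def)
  show "\<alpha> * (1 - exp (- c)) \<le> switching_tail h c x"
    if "0 < x" "x < 1" and critical: "- unit_deriv h x - c * h x = 0" for x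
  proof -
    have "c = - (unit_deriv h x / h x)"
      using critical threshold_function_pos[OF h, of x] that by (simp add: field_simps)
    then show ?thesis
      using strong_threshold_le_log_deriv[OF strong, of x] that by (simp add: switching_tail_def)
  qed
qed

text \<open>The probability that the picked value exceeds a level which a single item exceeds with
  probability \<open>z\<close>, if \<open>a i\<close> is the probability that the first \<open>i\<close> items are all rejected.\<close>

definition picked_tail :: "nat \<Rightarrow> (nat \<Rightarrow> real) \<Rightarrow> real \<Rightarrow> real" where
  "picked_tail n a z = (\<Sum>i<n. min (a i - a (Suc i)) (z * a i))"

lemma picked_tail_log_concave:
  assumes pos: "\<And>i. i \<le> n \<Longrightarrow> 0 < a i"
    and log_concave: "\<And>i. i + 2 \<le> n \<Longrightarrow> a i * a (i + 2) \<le> (a (i + 1))\<^sup>2"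
  obtains k where "k \<le> n" "picked_tail n a z = a 0 - a k + z * (\<Sum>i=k..<n. a i)"
proof -
  have "z * a (Suc i) \<le> a (Suc i) - a (Suc (Suc i))"
    if "Suc i < n" and decrement: "z * a i \<le> a i - a (Suc i)" for i
  proof -
    have "a i * a (Suc (Suc i)) \<le> a (Suc i) * a (Suc i)"
      using log_concave[of i] that by (simp add: power2_eq_square)
    also have "\<dots> \<le> (1 - z) * a i * a (Suc i)"
      using decrement pos[of "Suc i"] that by (intro mult_right_mono) (auto simp: algebra_simps)
    finally have "a i * a (Suc (Suc i)) \<le> a i * ((1 - z) * a (Suc i))"
      by (simp only: mult_ac)
    then have "a (Suc (Suc i)) \<le> (1 - z) * a (Suc i)"
      using pos[of i] that by simp
    then show ?thesis
      by (simp add: algebra_simps)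
  qed
  then obtain k where "k \<le> n"
    "picked_tail n a z = (\<Sum>i<k. a i - a (Suc i)) + (\<Sum>i=k..<n. z * a i)"
    unfolding picked_tail_def
    by (rule sum_min_single_crossing[of n "\<lambda>i. z * a i" "\<lambda>i. a i - a (Suc i)"])
  then show thesis
    using that by (simp add: sum_lessThan_telescope' sum_distrib_left)
qed

definition survival :: "(real \<Rightarrow> real) \<Rightarrow> nat \<Rightarrow> nat \<Rightarrow> real" where
  "survival h n i = h (real i / real n)"

lemma grid_point_in_unit_interval: "i \<le> n \<Longrightarrow> real i / real n \<in> {0..1}"
  by (auto simp: divide_simps)

lemma survival_pos:
  assumes "threshold_function h" "i \<le> n"
  shows "0 < survival h n i"
  unfolding survival_def
  using assms by (intro threshold_function_pos grid_point_in_unit_interval)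

lemma survival_log_concave:
  assumes "threshold_function h" "i + 2 \<le> n"
  shows "survival h n i * survival h n (i + 2) \<le> (survival h n (i + 1))\<^sup>2"
proof -
  have "midpoint (real i / real n) (real (i + 2) / real n) = real (i + 1) / real n"
    by (simp add: midpoint_def add_divide_distrib)
  moreover have "h (real i / real n) * h (real (i + 2) / real n)
      \<le> (h (midpoint (real i / real n) (real (i + 2) / real n)))\<^sup>2"
    using assms(2) grid_point_in_unit_interval[of _ n]
    by (intro concave_on_mult_le_square_midpoint[OF threshold_function_concave_on[OF assms(1)]]
        less_imp_le threshold_function_pos[OF assms(1)]) auto
  ultimately show ?thesis
    by (simp only: survival_def)
qed

lemma integral_le_sum_survival:
  assumes "antimono_on {0..1} h" "h integrable_on {0..1}" "k \<le> n" "1 \<le> n"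
  shows "real n * integral {real k / real n..1} h \<le> (\<Sum>i=k..<n. survival h n i)"
proof -
  have "mono (\<lambda>i. real i / real n)"
    by (auto intro!: monoI divide_right_mono)
  then have "integral {real k / real n..real n / real n} h
      \<le> (\<Sum>i=k..<n. (real (Suc i) / real n - real i / real n) * h (real i / real n))"
    using assms(3,4)
    by (intro integral_antimono_le_left_sum integrable_on_subinterval[OF assms(2)]
        monotone_on_subset[OF assms(1)]) auto
  also have "\<dots> = (\<Sum>i=k..<n. survival h n i) / real n"
    by (simp add: survival_def sum_divide_distrib flip: diff_divide_distrib)
  finally show ?thesis
    using \<open>1 \<le> n\<close> by (simp add: field_simps)
qed

lemma switching_tail_le_picked_tail:
  assumes "threshold_function h" "1 \<le> n" "0 \<le> z"
  obtains s where "s \<in> {0..1}" "switching_tail h (real n * z) s \<le> picked_tail n (survival h n) z"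
proof -
  obtain k where k: "k \<le> n" and
    picked: "picked_tail n (survival h n) z =
      survival h n 0 - survival h n k + z * (\<Sum>i=k..<n. survival h n i)"
    using picked_tail_log_concave[of n "survival h n" z] survival_pos[OF assms(1)]
      survival_log_concave[OF assms(1)] by blast
  have "z * (real n * integral {real k / real n..1} h) \<le> z * (\<Sum>i=k..<n. survival h n i)"
    using assms k
    by (intro mult_left_mono integral_le_sum_survival strict_antimono_on_imp_antimono_on
        integrable_continuous_real threshold_function_strict_antimono_on
        threshold_function_continuous_on)
  then have "switching_tail h (real n * z) (real k / real n) \<le> picked_tail n (survival h n) z"
    unfolding picked switching_tail_def survival_def
    using threshold_function_at_0[OF assms(1)] by (simp add: mult_ac)
  with grid_point_in_unit_interval[OF k] show thesis
    by (rule that)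
qed

lemma strong_threshold_le_picked_tail:
  assumes "0 < \<alpha>" "strong_threshold \<alpha> h" "1 \<le> n" "0 \<le> z" "z \<le> 1"
  shows "\<alpha> / (1 + 2 / real n) * (1 - (1 - z) ^ n) \<le> picked_tail n (survival h n) z"
proof -
  have "\<alpha> / (1 + 2 / real n) * (1 - (1 - z) ^ n)
      \<le> \<alpha> / (1 + 2 / real n) * ((1 + 2 / real n) * (1 - exp (- (real n * z))))"
    using assms by (intro mult_left_mono one_minus_power_le_one_minus_exp) auto
  also have "\<dots> = \<alpha> * (1 - exp (- (real n * z)))"
    by (simp add: add_pos_nonneg less_imp_neq[symmetric])
  also obtain s where "s \<in> {0..1}"
    and s: "switching_tail h (real n * z) s \<le> picked_tail n (survival h n) z"
    using switching_tail_le_picked_tail[OF strong_threshold_imp_threshold_function] assms by metis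
  then have "\<alpha> * (1 - exp (- (real n * z))) \<le> switching_tail h (real n * z) s"
    using assms by (intro strong_threshold_le_switching_tail) auto
  also note s
  finally show ?thesis .
qed

section \<open>Expectations and tails\<close>

lemma nn_integral_eq_nn_integral_tail:
  fixes f :: "'a \<Rightarrow> real"
  assumes "sigma_finite_measure M" and [measurable]: "f \<in> borel_measurable M"
  shows "(\<integral>\<^sup>+\<omega>. ennreal (f \<omega>) \<partial>M) =
    (\<integral>\<^sup>+t. indicator {0..} t * emeasure M {\<omega> \<in> space M. t < f \<omega>} \<partial>lborel)"
proof -
  interpret M: sigma_finite_measure M by fact
  interpret pair_sigma_finite M lborel by unfold_locales
  define A where "A = {x \<in> space (M \<Otimes>\<^sub>M lborel). 0 \<le> snd x \<and> snd x < f (fst x)}"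
  have [measurable]: "A \<in> sets (M \<Otimes>\<^sub>M lborel)"
    unfolding A_def by measurable
  have "(\<integral>\<^sup>+\<omega>. ennreal (f \<omega>) \<partial>M) = (\<integral>\<^sup>+\<omega>. emeasure lborel (Pair \<omega> -` A) \<partial>M)"
  proof (intro nn_integral_cong)
    fix \<omega> assume "\<omega> \<in> space M"
    then have "Pair \<omega> -` A = {0..<f \<omega>}"
      by (auto simp: A_def space_pair_measure)
    then show "ennreal (f \<omega>) = emeasure lborel (Pair \<omega> -` A)"
      by (cases "0 \<le> f \<omega>") (auto simp: ennreal_neg)
  qed
  also have "\<dots> = emeasure (M \<Otimes>\<^sub>M lborel) A"
    by (intro lborel.emeasure_pair_measure_alt[symmetric]) measurable
  also have "\<dots> = (\<integral>\<^sup>+t. emeasure M ((\<lambda>\<omega>. (\<omega>, t)) -` A) \<partial>lborel)"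
    by (intro emeasure_pair_measure_alt2) measurable
  also have "\<dots> = (\<integral>\<^sup>+t. indicator {0..} t * emeasure M {\<omega> \<in> space M. t < f \<omega>} \<partial>lborel)"
  proof (intro nn_integral_cong)
    fix t :: real
    have "(\<lambda>\<omega>. (\<omega>, t)) -` A = (if 0 \<le> t then {\<omega> \<in> space M. t < f \<omega>} else {})"
      by (auto simp: A_def space_pair_measure)
    then show "emeasure M ((\<lambda>\<omega>. (\<omega>, t)) -` A) =
        indicator {0..} t * emeasure M {\<omega> \<in> space M. t < f \<omega>}"
      by simp
  qed
  finally show ?thesis .
qed

lemma nn_integral_mono_tail:
  fixes f :: "'a \<Rightarrow> real" and g :: "'b \<Rightarrow> real" and C :: ennreal
  assumes "sigma_finite_measure M" "sigma_finite_measure N"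
    and [measurable]: "f \<in> borel_measurable M" "g \<in> borel_measurable N"
    and tail: "\<And>t. 0 \<le> t \<Longrightarrow>
      C * emeasure M {\<omega> \<in> space M. t < f \<omega>} \<le> emeasure N {\<omega> \<in> space N. t < g \<omega>}"
  shows "C * (\<integral>\<^sup>+\<omega>. ennreal (f \<omega>) \<partial>M) \<le> (\<integral>\<^sup>+\<omega>. ennreal (g \<omega>) \<partial>N)"
proof -
  interpret sigma_finite_measure M by fact
  have "C * (\<integral>\<^sup>+\<omega>. ennreal (f \<omega>) \<partial>M) =
      (\<integral>\<^sup>+t. C * (indicator {0..} t * emeasure M {\<omega> \<in> space M. t < f \<omega>}) \<partial>lborel)"
    unfolding nn_integral_eq_nn_integral_tail[OF assms(1,3)]
    by (intro nn_integral_cmult[symmetric]) measurable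
  also have "\<dots> \<le> (\<integral>\<^sup>+t. indicator {0..} t * emeasure N {\<omega> \<in> space N. t < g \<omega>} \<partial>lborel)"
    using tail by (intro nn_integral_mono) (auto simp: indicator_def)
  also have "\<dots> = (\<integral>\<^sup>+\<omega>. ennreal (g \<omega>) \<partial>N)"
    using assms(2,4) by (rule nn_integral_eq_nn_integral_tail[symmetric])
  finally show ?thesis .
qed

section \<open>Continuous distribution functions\<close>

context real_distribution
begin

lemma measure_lessThan_eq_cdf:
  assumes "isCont (cdf M) x"
  shows "measure M {..<x} = cdf M x"
proof -
  have "cdf M x = measure M {..<x} + measure M {x}"
    unfolding cdf_def ivl_disj_un(2)[symmetric] by (rule finite_measure_Union) auto
  then show ?thesis
    using assms by (simp add: isCont_cdf)
qed

lemma measure_atLeast_Int_greaterThan: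
  assumes "isCont (cdf M) x"
  shows "measure M ({x..} \<inter> {t<..}) = 1 - max (cdf M x) (cdf M t)"
proof -
  have "{x..} \<inter> {t<..} = space M - ({..<x} \<union> {..t})"
    by auto
  then have "measure M ({x..} \<inter> {t<..}) = 1 - measure M ({..<x} \<union> {..t})"
    using prob_compl[of "{..<x} \<union> {..t}"] by simp
  also have "measure M ({..<x} \<union> {..t}) = max (cdf M x) (cdf M t)"
  proof (cases "t < x")
    case True
    then have "{..<x} \<union> {..t} = {..<x}"
      by auto
    then show ?thesis
      using True cdf_nondecreasing[of t x] by (simp add: measure_lessThan_eq_cdf[OF assms])
  next
    case False
    then have "{..<x} \<union> {..t} = {..t}"
      by auto
    then show ?thesis
      using False cdf_nondecreasing[of x t] by (simp add: cdf_def2)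
  qed
  finally show ?thesis .
qed

lemma cdf_attains:
  assumes cont: "continuous_on UNIV (cdf M)" and "0 < y" "y < 1"
  obtains x where "cdf M x = y"
proof -
  have "\<forall>\<^sub>F x in at_bot. cdf M x < y" "\<forall>\<^sub>F x in at_top. y < cdf M x"
    using cdf_lim_at_bot cdf_lim_at_top_prob assms(2,3) by (auto intro: order_tendstoD)
  then obtain a b where ab: "cdf M a < y" "y < cdf M b"
    by (auto simp: eventually_at_bot_linorder eventually_at_top_linorder)
  moreover have "a \<le> b"
    using ab cdf_nondecreasing[of b a] by force
  ultimately show thesis
    using IVT'[of "cdf M" a y b] cont that by (meson continuous_on_subset less_imp_le subset_UNIV)
qed

lemma cdf_the_inv_into:
  assumes cdf: "continuous_increasing_on_interval (cdf M) I" and y: "0 < y" "y < 1"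
  shows "cdf M (the_inv_into I (cdf M) y) = y"
proof -
  obtain x where x: "cdf M x = y"
    using cdf_attains cdf y unfolding continuous_increasing_on_interval_def by metis
  then have "x \<in> I" "inj_on (cdf M) I"
    using cdf y unfolding continuous_increasing_on_interval_def
    by (auto intro: strict_mono_on_imp_inj_on)
  then show ?thesis
    using f_the_inv_into_f[of "cdf M" I y] x by blast
qed

lemma cdf_threshold:
  assumes h: "threshold_function h" and cdf: "continuous_increasing_on_interval (cdf M) I"
    and i: "i < n"
  shows "cdf M (threshold h (cdf M) I n (Suc i)) = survival h n (Suc i) / survival h n i"
proof -
  have "survival h n (Suc i) < survival h n i"
    unfolding survival_def using i grid_point_in_unit_interval[of i n]
      grid_point_in_unit_interval[of "Suc i" n]
    by (intro monotone_onD[OF threshold_function_strict_antimono_on[OF h]])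
      (auto simp: divide_strict_right_mono)
  moreover have "threshold h (cdf M) I n (Suc i) =
      the_inv_into I (cdf M) (survival h n (Suc i) / survival h n i)"
    by (simp add: threshold_def survival_def)
  ultimately show ?thesis
    using survival_pos[OF h, of _ n] i by (simp add: cdf_the_inv_into[OF cdf])
qed

end

section \<open>The threshold algorithm on i.i.d. items\<close>

lemma picked_value_Suc:
  "picked_value (Suc n) \<theta> x =
    (if \<exists>i\<in>{1..n}. \<theta> i \<le> x i then picked_value n \<theta> x
     else if \<theta> (Suc n) \<le> x (Suc n) then x (Suc n) else 0)"
proof (cases "\<exists>i\<in>{1..n}. \<theta> i \<le> x i")
  case True
  define first where "first = (LEAST i. i \<in> {1..n} \<and> \<theta> i \<le> x i)"
  have first: "first \<in> {1..n}" "\<theta> first \<le> x first"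
    using True LeastI_ex[of "\<lambda>i. i \<in> {1..n} \<and> \<theta> i \<le> x i"] unfolding first_def by blast+
  have "(LEAST i. i \<in> {1..Suc n} \<and> \<theta> i \<le> x i) = first"
  proof (rule Least_equality)
    fix i assume i: "i \<in> {1..Suc n} \<and> \<theta> i \<le> x i"
    show "first \<le> i"
    proof (cases "i = Suc n")
      case False
      with i show ?thesis
        unfolding first_def by (intro Least_le) auto
    qed (use first in auto)
  qed (use first in auto)
  moreover have "\<exists>i\<in>{1..Suc n}. \<theta> i \<le> x i"
    using True by force
  ultimately show ?thesis
    using True by (simp only: picked_value_def first_def if_True)
next
  case False
  have "(LEAST i. i \<in> {1..Suc n} \<and> \<theta> i \<le> x i) = Suc n" if "\<theta> (Suc n) \<le> x (Suc n)"
    using False that by (intro Least_equality) (auto simp: le_Suc_eq)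
  moreover have "(\<exists>i\<in>{1..Suc n}. \<theta> i \<le> x i) \<longleftrightarrow> \<theta> (Suc n) \<le> x (Suc n)"
    using False by (auto simp: atLeastAtMostSuc_conv)
  ultimately show ?thesis
    using False by (simp only: picked_value_def if_False cong: if_cong)
qed

lemma less_picked_value_imp_accepted:
  assumes "0 \<le> t" "t < picked_value n \<theta> x"
  shows "\<exists>i\<in>{1..n}. \<theta> i \<le> x i"
  using assms by (auto simp: picked_value_def split: if_splits)

lemma less_picked_value_Suc_iff:
  assumes "0 \<le> t"
  shows "t < picked_value (Suc n) \<theta> x \<longleftrightarrow> t < picked_value n \<theta> x \<or>
    \<not> (\<exists>i\<in>{1..n}. \<theta> i \<le> x i) \<and> \<theta> (Suc n) \<le> x (Suc n) \<and> t < x (Suc n)"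
  using assms less_picked_value_imp_accepted[of t n \<theta> x]
  by (cases "\<exists>i\<in>{1..n}. \<theta> i \<le> x i") (auto simp: picked_value_Suc)

lemma borel_measurable_picked_value:
  assumes "\<And>i. i \<in> {1..n} \<Longrightarrow> X i \<in> borel_measurable M"
  shows "(\<lambda>\<omega>. picked_value n \<theta> (\<lambda>i. X i \<omega>)) \<in> borel_measurable M"
  using assms
proof (induction n)
  case 0
  then show ?case
    by (simp add: picked_value_def)
next
  case (Suc n)
  then have [measurable]: "(\<lambda>\<omega>. picked_value n \<theta> (\<lambda>i. X i \<omega>)) \<in> borel_measurable M"
    "X (Suc n) \<in> borel_measurable M" "i \<in> {1..n} \<Longrightarrow> X i \<in> borel_measurable M" for i
    by auto
  show ?case
    unfolding picked_value_Suc by measurable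
qed

locale iid_sample = prob_space M + D: real_distribution D
  for M :: "'a measure" and D :: "real measure" +
  fixes n :: nat and X :: "nat \<Rightarrow> 'a \<Rightarrow> real"
  assumes indep: "indep_vars (\<lambda>_. borel) X {1..n}"
    and distr_X: "\<And>i. i \<in> {1..n} \<Longrightarrow> distr M borel (X i) = D"
begin

lemma random_variable_X: "i \<in> {1..n} \<Longrightarrow> random_variable borel (X i)"
  using indep by (simp add: indep_vars_def2)

lemma prob_all_in:
  assumes J: "J \<subseteq> {1..n}" and A: "\<And>j. j \<in> J \<Longrightarrow> A j \<in> sets borel"
  shows "prob {\<omega> \<in> space M. \<forall>j\<in>J. X j \<omega> \<in> A j} = (\<Prod>j\<in>J. measure D (A j))"
proof (cases "J = {}")
  case True
  then show ?thesis
    by (simp add: prob_space)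
next
  case False
  have "prob (X j -` A j \<inter> space M) = measure D (A j)" if "j \<in> J" for j
  proof -
    have "j \<in> {1..n}"
      using that J by blast
    then show ?thesis
      using measure_distr[OF random_variable_X A] that by (simp add: distr_X)
  qed
  moreover have "{\<omega> \<in> space M. \<forall>j\<in>J. X j \<omega> \<in> A j} = (\<Inter>j\<in>J. X j -` A j \<inter> space M)"
    using False by auto
  moreover have "finite J"
    using J finite_subset by blast
  ultimately show ?thesis
    using indep_varsD[OF indep False _ J A] by simp
qed

lemma prob_Max_greater:
  assumes "1 \<le> n"
  shows "prob {\<omega> \<in> space M. t < Max ((\<lambda>i. X i \<omega>) ` {1..n})} = 1 - cdf D t ^ n"
proof -
  let ?below = "{\<omega> \<in> space M. \<forall>i\<in>{1..n}. X i \<omega> \<in> {..t}}"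
  have "{\<omega> \<in> space M. t < Max ((\<lambda>i. X i \<omega>) ` {1..n})} = space M - ?below"
    using assms by (subst Max_gr_iff) (auto simp: not_le[symmetric])
  moreover have "?below \<in> events"
    using random_variable_X by measurable
  ultimately show ?thesis
    using prob_compl[of ?below] prob_all_in[of "{1..n}" "\<lambda>_. {..t}"] by (simp add: cdf_def2)
qed

lemma prob_picked_value_greater:
  assumes "0 \<le> t" "m \<le> n"
  shows "prob {\<omega> \<in> space M. t < picked_value m \<theta> (\<lambda>i. X i \<omega>)} =
    (\<Sum>i<m. (\<Prod>j<i. measure D {..<\<theta> (Suc j)}) * measure D ({\<theta> (Suc i)..} \<inter> {t<..}))"
  using \<open>m \<le> n\<close>
proof (induction m)
  case 0
  then show ?case
    using \<open>0 \<le> t\<close> by (simp add: picked_value_def)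
next
  case (Suc m)
  define A where "A j = (if j \<le> m then {..<\<theta> j} else {\<theta> j..} \<inter> {t<..})" for j
  have [measurable]: "A j \<in> sets borel" for j
    by (simp add: A_def)
  define earlier where "earlier = {\<omega> \<in> space M. t < picked_value m \<theta> (\<lambda>i. X i \<omega>)}"
  define last where "last = {\<omega> \<in> space M. \<forall>j\<in>{1..Suc m}. X j \<omega> \<in> A j}"
  have last_iff: "\<omega> \<in> last \<longleftrightarrow> \<omega> \<in> space M \<and> \<not> (\<exists>j\<in>{1..m}. \<theta> j \<le> X j \<omega>) \<and>
      \<theta> (Suc m) \<le> X (Suc m) \<omega> \<and> t < X (Suc m) \<omega>" for \<omega>
    by (auto simp: last_def A_def le_Suc_eq not_le)
  have split: "{\<omega> \<in> space M. t < picked_value (Suc m) \<theta> (\<lambda>i. X i \<omega>)} = earlier \<union> last"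
    by (intro set_eqI) (auto simp only: less_picked_value_Suc_iff[OF \<open>0 \<le> t\<close>] last_iff earlier_def
        Un_iff mem_Collect_eq)
  have disjoint: "earlier \<inter> last = {}"
    using less_picked_value_imp_accepted[OF \<open>0 \<le> t\<close>] by (auto simp: last_iff earlier_def)
  have X: "random_variable borel (X j)" if "j \<in> {1..Suc m}" for j
    using that Suc.prems by (intro random_variable_X) auto
  then have "earlier \<in> events"
    using borel_measurable_picked_value[of m X M \<theta>] unfolding earlier_def by measurable
  moreover have "last \<in> events"
    using X unfolding last_def by measurable
  ultimately have "prob (earlier \<union> last) = prob earlier + prob last"
    using disjoint by (rule finite_measure_Union)
  also have "prob last = (\<Prod>j<Suc m. measure D (A (Suc j)))"
    using Suc.prems unfolding last_def
    by (subst prob_all_in) (auto simp: A_def prod.atLeast1_atMost_eq)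
  also have "\<dots> = (\<Prod>j<m. measure D {..<\<theta> (Suc j)}) * measure D ({\<theta> (Suc m)..} \<inter> {t<..})"
    by (simp add: A_def)
  finally show ?case
    using Suc by (simp add: split earlier_def)
qed

lemma prob_picked_value_greater_eq_picked_tail:
  assumes cont: "continuous_on UNIV (cdf D)" and "0 \<le> t"
    and "a 0 = 1" and pos: "\<And>i. i \<le> n \<Longrightarrow> 0 < a i"
    and \<theta>: "\<And>i. i < n \<Longrightarrow> cdf D (\<theta> (Suc i)) = a (Suc i) / a i"
  shows "prob {\<omega> \<in> space M. t < picked_value n \<theta> (\<lambda>i. X i \<omega>)} = picked_tail n a (1 - cdf D t)"
proof -
  have isCont: "isCont (cdf D) x" for x
    using cont by (simp add: continuous_on_eq_continuous_at)
  have reject: "(\<Prod>j<i. measure D {..<\<theta> (Suc j)}) = a i" if "i \<le> n" for i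
    using that
  proof (induction i)
    case (Suc i)
    then show ?case
      using pos[of i] by (simp add: D.measure_lessThan_eq_cdf[OF isCont] \<theta>)
  qed (simp add: \<open>a 0 = 1\<close>)
  have "a i * (1 - max (a (Suc i) / a i) (cdf D t)) =
      min (a i - a (Suc i)) ((1 - cdf D t) * a i)" if "i < n" for i
    using pos[of i] that by (auto simp: max_def min_def field_simps)
  then show ?thesis
    unfolding picked_tail_def prob_picked_value_greater[OF \<open>0 \<le> t\<close> order_refl]
    by (intro sum.cong) (auto simp: reject D.measure_atLeast_Int_greaterThan[OF isCont] \<theta>)
qed

lemma strong_threshold_expectation_picked_value_ge:
  assumes "1 \<le> n" and cont: "continuous_on UNIV (cdf D)"
    and "0 < \<alpha>" and strong: "strong_threshold \<alpha> h"
    and \<theta>: "\<And>i. i < n \<Longrightarrow> cdf D (\<theta> (Suc i)) = survival h n (Suc i) / survival h n i"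
    and K: "K \<le> \<alpha> / (1 + 2 / real n)"
  shows "ennreal K * (\<integral>\<^sup>+\<omega>. ennreal (Max ((\<lambda>i. X i \<omega>) ` {1..n})) \<partial>M)
    \<le> (\<integral>\<^sup>+\<omega>. ennreal (picked_value n \<theta> (\<lambda>i. X i \<omega>)) \<partial>M)"
proof (rule nn_integral_mono_tail)
  note h = strong_threshold_imp_threshold_function[OF strong]
  show "(\<lambda>\<omega>. Max ((\<lambda>i. X i \<omega>) ` {1..n})) \<in> borel_measurable M"
    using random_variable_X by (intro borel_measurable_Max) auto
  show "(\<lambda>\<omega>. picked_value n \<theta> (\<lambda>i. X i \<omega>)) \<in> borel_measurable M"
    using random_variable_X by (intro borel_measurable_picked_value) auto
  fix t :: real assume "0 \<le> t"
  have "K * (1 - cdf D t ^ n) \<le> \<alpha> / (1 + 2 / real n) * (1 - cdf D t ^ n)"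
    using K by (intro mult_right_mono) (auto simp: power_le_one D.cdf_nonneg D.cdf_bounded_prob)
  also have "\<dots> \<le> picked_tail n (survival h n) (1 - cdf D t)"
    using strong_threshold_le_picked_tail[OF \<open>0 < \<alpha>\<close> strong \<open>1 \<le> n\<close>, of "1 - cdf D t"]
      D.cdf_nonneg D.cdf_bounded_prob by simp
  also have "\<dots> = prob {\<omega> \<in> space M. t < picked_value n \<theta> (\<lambda>i. X i \<omega>)}"
    using cont \<open>0 \<le> t\<close> threshold_function_at_0[OF h] survival_pos[OF h] \<theta>
    by (intro prob_picked_value_greater_eq_picked_tail[symmetric]) (auto simp: survival_def)
  finally show "ennreal K * emeasure M {\<omega> \<in> space M. t < Max ((\<lambda>i. X i \<omega>) ` {1..n})}
    \<le> emeasure M {\<omega> \<in> space M. t < picked_value n \<theta> (\<lambda>i. X i \<omega>)}"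
    unfolding emeasure_eq_measure prob_Max_greater[OF \<open>1 \<le> n\<close>, symmetric]
    by (simp add: ennreal_mult''[symmetric] ennreal_leI)
qed (rule sigma_finite_measure_axioms)+

end

lemma iid_items_imp_iid_sample:
  assumes "iid_items M n X (cdf D)" "real_distribution D"
  shows "iid_sample M D n X"
proof -
  interpret prob_space M
    using assms by (simp add: iid_items_def)
  have "distr M borel (X i) = D" if "i \<in> {1..n}" for i
    using assms that by (intro cdf_unique real_distribution_distr)
      (auto simp: iid_items_def indep_vars_def2)
  with assms show ?thesis
    by (simp add: iid_sample_def iid_sample_axioms_def iid_items_def)
qed

theorem theorem6:
  fixes \<alpha> :: real and h F :: "real \<Rightarrow> real" and I :: "real set"
  assumes "0 < \<alpha>" and "\<alpha> \<le> 1"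
    and "strong_threshold \<alpha> h"
    and "nonneg_distribution_function F"
    and "continuous_increasing_on_interval F I"
  shows "\<forall>\<epsilon>>0. \<exists>n\<^sub>\<epsilon>\<ge>1. \<forall>n\<ge>n\<^sub>\<epsilon>. \<forall>(M :: 'a measure) X. iid_items M n X F \<longrightarrow>
    ennreal ((1 - \<epsilon>) * \<alpha>) * (\<integral>\<^sup>+\<omega>. ennreal (Max ((\<lambda>i. X i \<omega>) ` {1..n})) \<partial>M)
      \<le> (\<integral>\<^sup>+\<omega>. ennreal (picked_value n (threshold h F I n) (\<lambda>i. X i \<omega>)) \<partial>M)"
proof (intro allI impI)
  fix \<epsilon> :: real assume "0 < \<epsilon>"
  obtain D where D: "real_distribution D" and F: "cdf D = F"
    using assms(4) by (auto simp: nonneg_distribution_function_def)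
  obtain N where N: "\<And>n. N \<le> n \<Longrightarrow> 1 - \<epsilon> < 1 / (1 + 2 / real n)"
    using eventually_one_minus_less_inverse[OF \<open>0 < \<epsilon>\<close>] by (auto simp: eventually_sequentially)
  have "ennreal ((1 - \<epsilon>) * \<alpha>) * (\<integral>\<^sup>+\<omega>. ennreal (Max ((\<lambda>i. X i \<omega>) ` {1..n})) \<partial>M)
      \<le> (\<integral>\<^sup>+\<omega>. ennreal (picked_value n (threshold h F I n) (\<lambda>i. X i \<omega>)) \<partial>M)"
    if "max 1 N \<le> n" "iid_items M n X F" for n X and M :: "'a measure"
  proof -
    interpret iid_sample M D n X
      using iid_items_imp_iid_sample that(2) D F by blast
    have "(1 - \<epsilon>) * \<alpha> \<le> \<alpha> / (1 + 2 / real n)"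
      using mult_strict_right_mono[OF N \<open>0 < \<alpha>\<close>, of n] that(1) by simp
    moreover have "cdf D (threshold h F I n (Suc i)) = survival h n (Suc i) / survival h n i"
      if "i < n" for i
      using D.cdf_threshold[OF strong_threshold_imp_threshold_function] assms(3,5) that F by blast
    ultimately show ?thesis
      using assms(1,3,5) that(1)
      by (intro strong_threshold_expectation_picked_value_ge)
        (auto simp: F continuous_increasing_on_interval_def)
  qed
  then show "\<exists>n\<^sub>\<epsilon>\<ge>1. \<forall>n\<ge>n\<^sub>\<epsilon>. \<forall>(M :: 'a measure) X. iid_items M n X F \<longrightarrow>
    ennreal ((1 - \<epsilon>) * \<alpha>) * (\<integral>\<^sup>+\<omega>. ennreal (Max ((\<lambda>i. X i \<omega>) ` {1..n})) \<partial>M)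
      \<le> (\<integral>\<^sup>+\<omega>. ennreal (picked_value n (threshold h F I n) (\<lambda>i. X i \<omega>)) \<partial>M)"
    by (intro exI[of _ "max 1 N"]) simp
qed

end
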